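(* Let $D=(V,A)$ be a digraph and let $b \in \mathbb{Z}_{++}^V$. Let $V' \subseteq V$ and let $b' \in \mathbb{Z}_{+}^{V'}$ satisfy $b'(v) \le b(v)$ for every $v \in V'$. Then the convex hull of the incidence vectors (in $\mathbb{R}^A$) of the $b$-branchings $B$ in $D$ with $d^-_B(v)=b'(v)$ for every $v \in V'$ has the integer decomposition property.
   Context: $\mathbb{Z}_{++}$ and $\mathbb{Z}_+$ denote the positive and nonnegative integers. For a digraph $D=(V,A)$, $F \subseteq A$ and $v \in V$, $d^-_F(v)$ is the number of arcs of $F$ with head $v$. For $X \subseteq V$, $b(X)=\sum_{v \in X} b(v)$ and $F[X]$ is the set of arcs of $F$ with both ends in $X$. An arc set $B \subseteq A$ is a $b$-branching if $d^-_B(v) \le b(v)$ for every $v \in V$ and $|B[X]| \le b(X)-1$ for every nonempty $X \subseteq V$. For a polytope $P$ and positive integer $\kappa$, $\kappa P=\{\kappa x' \mid x' \in P\}$. A polytope $P$ has the integer decomposition property if for every positive integer $\kappa$ and every integer vector $x \in \kappa P$ there exist $\kappa$ integer vectors $x_1,\ldots,x_\kappa \in P$ with $x = x_1+\cdots+x_\kappa$. *)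

theory Defs
  imports "HOL-Analysis.Analysis" "Graph_Theory.Digraph"
begin

definition indeg_in :: "('v, 'e) pre_digraph \<Rightarrow> 'e set \<Rightarrow> 'v \<Rightarrow> nat" where
  "indeg_in D F v = card (F \<inter> in_arcs D v)"

definition arcs_inside :: "('v, 'e) pre_digraph \<Rightarrow> 'e set \<Rightarrow> 'v set \<Rightarrow> 'e set" where
  "arcs_inside D F X = {e \<in> F. tail D e \<in> X \<and> head D e \<in> X}"

definition b_branching :: "('v, 'e) pre_digraph \<Rightarrow> ('v \<Rightarrow> nat) \<Rightarrow> 'e set \<Rightarrow> bool" where
  "b_branching D b B \<longleftrightarrow>
     B \<subseteq> arcs D \<and>
     (\<forall>v \<in> verts D. indeg_in D B v \<le> b v) \<and>
     (\<forall>X. X \<subseteq> verts D \<and> X \<noteq> {} \<longrightarrow>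
        int (card (arcs_inside D B X)) \<le> int (\<Sum>v\<in>X. b v) - 1)"

text \<open>
  The arcs of a digraph are drawn from a finite type \<open>'e\<close>, and \<open>\<real>\<^sup>A\<close> is the coordinate
  subspace of \<open>real ^ 'e\<close> of the vectors that vanish outside \<open>A\<close> (all of \<open>real ^ 'e\<close> if
  \<open>A = UNIV\<close>; a proper subset is allowed so that \<open>A\<close> may be empty).
\<close>

definition incidence_vector :: "'e set \<Rightarrow> real ^ 'e" where
  "incidence_vector B = (\<chi> e. if e \<in> B then 1 else 0)"

definition integer_vector :: "real ^ 'e \<Rightarrow> bool" where
  "integer_vector x \<longleftrightarrow> (\<forall>e. x $ e \<in> \<int>)"

definition integer_decomposition_property :: "(real ^ 'e::finite) set \<Rightarrow> bool" where
  "integer_decomposition_property P \<longleftrightarrow>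
     (\<forall>\<kappa>::nat. \<kappa> > 0 \<longrightarrow>
       (\<forall>x. integer_vector x \<and> x \<in> (\<lambda>x'. real \<kappa> *\<^sub>R x') ` P \<longrightarrow>
         (\<exists>y. (\<forall>i\<in>{1..\<kappa>}. integer_vector (y i) \<and> y i \<in> P) \<and> x = (\<Sum>i=1..\<kappa>. y i))))"

definition prescribed_b_branching_polytope ::
    "('v, 'e::finite) pre_digraph \<Rightarrow> ('v \<Rightarrow> nat) \<Rightarrow> 'v set \<Rightarrow> ('v \<Rightarrow> nat) \<Rightarrow> (real ^ 'e) set" where
  "prescribed_b_branching_polytope D b V' b' =
     convex hull (incidence_vector ` {B. b_branching D b B \<and> (\<forall>v\<in>V'. indeg_in D B v = b' v)})"

lemma polytope_prescribed_b_branching_polytope: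
  "polytope (prescribed_b_branching_polytope D b V' b')"
  unfolding prescribed_b_branching_polytope_def by (intro polytope_convex_hull) auto

end

theory Submission
  imports Defs
begin

text \<open>
  An integer vector \<open>x\<close> of the \<open>\<kappa>\<close>-th dilate is a multiset of arcs. Add a root and
  \<open>\<kappa> b(v) - x(\<delta>\<^sup>-(v))\<close> root arcs into each \<open>v\<close>, so that every vertex has in-degree exactly
  \<open>\<kappa> b(v)\<close>; the sparsity inequalities then say that every nonempty set of vertices is entered
  by at least \<open>\<kappa>\<close> arcs, and Edmonds' theorem provides \<open>\<kappa>\<close> disjoint spanning arborescences.
  Adding arcs to an arborescence keeps every vertex set entered, so the remaining arcs can be
  distributed independently at each vertex: \<open>b(v) - 1\<close> further ones to each arborescence, no
  arc being used twice by the same one. The prescribed in-degrees come out right because at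
  \<open>v \<in> V'\<close> the root arcs form \<open>b(v) - b'(v)\<close> parallel classes of size \<open>\<kappa>\<close>, each of which
  must then meet every part.
\<close>

section \<open>Edmonds' disjoint arborescences theorem with capacities\<close>

text \<open>Tails are unrestricted: an arc whose tail lies outside \<open>V\<close> counts as
  leaving the root. Parallel arcs are expressed by capacities.\<close>

locale capacitated_digraph =
  fixes E :: "'a set" and hd tl :: "'a \<Rightarrow> 'w" and V :: "'w set"
  assumes finE: "finite E" and finV: "finite V" and hd_V: "e \<in> E \<Longrightarrow> hd e \<in> V"
begin

definition cut :: "('a \<Rightarrow> nat) \<Rightarrow> 'w set \<Rightarrow> nat" where
  "cut c X = (\<Sum>e\<in>E. if hd e \<in> X \<and> tl e \<notin> X then c e else 0)"

lemma cut_submodular: "cut c (X \<inter> Y) + cut c (X \<union> Y) \<le> cut c X + cut c Y"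
  unfolding cut_def sum.distrib[symmetric] by (rule sum_mono) auto

lemma cut_cong:
  assumes "\<And>e. e \<in> E \<Longrightarrow> hd e \<in> X \<Longrightarrow> tl e \<notin> X \<Longrightarrow> c e = c' e"
  shows "cut c X = cut c' X"
  unfolding cut_def by (rule sum.cong) (auto simp: assms)

lemma cut_less_arc:
  assumes "cut c X < cut c Y"
  obtains e where "e \<in> E" "c e > 0" "hd e \<in> Y" "tl e \<notin> Y" "hd e \<notin> X \<or> tl e \<in> X"
proof -
  have "\<exists>e\<in>E. (if hd e \<in> X \<and> tl e \<notin> X then c e else 0) < (if hd e \<in> Y \<and> tl e \<notin> Y then c e else 0)"
    using assms unfolding cut_def by (meson linorder_not_le sum_mono)
  then show ?thesis
    using that by (auto split: if_splits)
qed

text \<open>The growth step for an arborescence that has reached \<open>U\<close>: the arc found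
  leads to a new vertex, and giving up one unit of its capacity keeps every cut at least
  \<open>k\<close>.\<close>

lemma exists_safe_arc:
  assumes U: "U \<subset> V"
    and cut_ge: "\<And>X. X \<subseteq> V \<Longrightarrow> X \<noteq> {} \<Longrightarrow> k \<le> cut c X"
    and cut_gt: "\<And>X. X \<subseteq> V - U \<Longrightarrow> X \<noteq> {} \<Longrightarrow> k < cut c X"
  obtains e where "e \<in> E" "c e > 0" "hd e \<in> V - U" "tl e \<notin> V - U"
    "\<And>X. X \<subseteq> V \<Longrightarrow> hd e \<in> X \<Longrightarrow> tl e \<notin> X \<Longrightarrow> k < cut c X"
proof -
  \<comment> \<open>Sets inside \<open>U\<close> are left out: the arc sought has its head in
    \<open>V - U\<close>, so it cannot enter them.\<close>
  define tight where "tight = {X. X \<subseteq> V \<and> \<not> X \<subseteq> U \<and> cut c X = k}"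
  show ?thesis
  proof (cases "tight = {}")
    case True
    \<comment> \<open>As \<open>cut c {}\<close> is 0, this merely yields some arc of positive
      capacity entering \<open>V - U\<close>; with no tight set, any such arc is safe.\<close>
    have "cut c {} < cut c (V - U)"
      using cut_gt[of "V - U"] U by (fastforce simp: cut_def)
    then obtain e where e: "e \<in> E" "c e > 0" "hd e \<in> V - U" "tl e \<notin> V - U"
      by (rule cut_less_arc)
    have "k < cut c X" if "X \<subseteq> V" "hd e \<in> X" "tl e \<notin> X" for X
    proof -
      have "X \<notin> tight"
        using True by simp
      then show ?thesis
        using that e cut_ge[of X] by (fastforce simp: tight_def)
    qed
    with e show ?thesis
      by (rule that)
  next
    case False
    text \<open>Lovasz's uncrossing: an arc inside a minimal tight set \<open>X\<close> that enters \<open>X - U\<close> cannot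
      enter another tight set \<open>Y\<close>, since \<open>X \<inter> Y\<close> would be a smaller one.\<close>
    have "finite tight"
      by (rule finite_subset[of _ "Pow V"]) (auto simp: tight_def finV)
    then obtain X where X: "X \<in> tight" and min: "\<And>Y. Y \<in> tight \<Longrightarrow> Y \<subseteq> X \<Longrightarrow> X = Y"
      using finite_has_minimal[OF _ False] by metis
    have XV: "X \<subseteq> V" and XU: "\<not> X \<subseteq> U" and ctX: "cut c X = k"
      using X by (auto simp: tight_def)
    \<comment> \<open>\<open>X - U\<close> avoids \<open>U\<close>, so it is entered more than
      \<open>k\<close> times. The arc obtained does not enter \<open>X\<close>, hence its tail is in
      \<open>X \<inter> U\<close>.\<close>
    have "cut c X < cut c (X - U)"
      unfolding ctX by (rule cut_gt) (use XV XU in auto)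
    then obtain e where e: "e \<in> E" "c e > 0" "hd e \<in> X - U" "tl e \<notin> X - U"
      "hd e \<notin> X \<or> tl e \<in> X"
      by (rule cut_less_arc)
    show ?thesis
    proof (rule that)
      show "e \<in> E" "c e > 0" "hd e \<in> V - U" "tl e \<notin> V - U"
        using e XV by auto
      fix Y assume Y: "Y \<subseteq> V" "hd e \<in> Y" "tl e \<notin> Y"
      show "k < cut c Y"
      proof (rule ccontr)
        assume "\<not> k < cut c Y"
        then have "cut c (X \<inter> Y) + cut c (X \<union> Y) \<le> k + k"
          using cut_submodular[of c X Y] ctX by linarith
        moreover have "k \<le> cut c (X \<inter> Y)" "k \<le> cut c (X \<union> Y)"
          using XV Y e by (auto intro!: cut_ge)
        ultimately have "cut c (X \<inter> Y) = k"
          by linarith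
        then have "X \<inter> Y \<in> tight"
          using XV e Y by (auto simp: tight_def)
        then have "X = X \<inter> Y"
          by (rule min) auto
        then show False
          using e Y by auto
      qed
    qed
  qed
qed

text \<open>The arborescence is grown from the root by safe arcs. It is encoded by the arc
  \<open>f v\<close> entering each \<open>v\<close>; that every nonempty set is entered by one of
  these arcs says that following tails backwards from any vertex eventually leaves
  \<open>V\<close>.\<close>

lemma exists_removable_arborescence:
  assumes cut_ge: "\<And>X. X \<subseteq> V \<Longrightarrow> X \<noteq> {} \<Longrightarrow> Suc k \<le> cut m X"
  obtains f c where
    "\<And>v. v \<in> V \<Longrightarrow> f v \<in> E \<and> hd (f v) = v"
    "\<And>X. X \<subseteq> V \<Longrightarrow> X \<noteq> {} \<Longrightarrow> \<exists>v\<in>X. tl (f v) \<notin> X"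
    "\<And>e. e \<in> E \<Longrightarrow> m e = c e + of_bool (f (hd e) = e)"
    "\<And>X. X \<subseteq> V \<Longrightarrow> X \<noteq> {} \<Longrightarrow> k \<le> cut c X"
proof -
  \<comment> \<open>\<open>U\<close> is the set reached so far and \<open>c\<close> the capacity
    left over; a tail outside \<open>V - U\<close> is in \<open>U\<close> or at the root.\<close>
  define partial where "partial U f c \<longleftrightarrow> U \<subseteq> V \<and>
      (\<forall>v\<in>U. f v \<in> E \<and> hd (f v) = v \<and> tl (f v) \<notin> V - U) \<and>
      (\<forall>X. X \<subseteq> U \<and> X \<noteq> {} \<longrightarrow> (\<exists>v\<in>X. tl (f v) \<notin> X)) \<and>
      (\<forall>e\<in>E. m e = c e + of_bool (hd e \<in> U \<and> f (hd e) = e)) \<and>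
      (\<forall>X. X \<subseteq> V \<and> X \<noteq> {} \<longrightarrow> k \<le> cut c X)" for U f c
  have "n \<le> card V \<Longrightarrow> \<exists>U f c. partial U f c \<and> card U = n" for n
  proof (induction n)
    case 0
    have "partial {} f m" for f
      using cut_ge by (auto simp: partial_def intro: Suc_leD)
    then show ?case
      using card.empty by blast
  next
    case (Suc n)
    then obtain U f c where "partial U f c" and cardU: "card U = n"
      by auto
    then have U: "U \<subseteq> V"
      and f: "\<And>v. v \<in> U \<Longrightarrow> f v \<in> E \<and> hd (f v) = v \<and> tl (f v) \<notin> V - U"
      and reach: "\<And>X. X \<subseteq> U \<Longrightarrow> X \<noteq> {} \<Longrightarrow> \<exists>v\<in>X. tl (f v) \<notin> X"
      and m: "\<And>e. e \<in> E \<Longrightarrow> m e = c e + of_bool (hd e \<in> U \<and> f (hd e) = e)"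
      and c: "\<And>X. X \<subseteq> V \<Longrightarrow> X \<noteq> {} \<Longrightarrow> k \<le> cut c X"
      unfolding partial_def by metis+
    have "U \<subset> V"
      using U cardU Suc.prems by auto
    \<comment> \<open>All arcs used so far have their heads in \<open>U\<close>, so sets disjoint
      from \<open>U\<close> still have their original cut of at least \<open>Suc k\<close>.\<close>
    moreover have "k < cut c X" if X: "X \<subseteq> V - U" "X \<noteq> {}" for X
    proof -
      have "cut c X = cut m X"
        using X by (intro cut_cong) (auto simp: m)
      moreover have "Suc k \<le> cut m X"
        by (rule cut_ge) (use X in auto)
      ultimately show ?thesis
        by simp
    qed
    ultimately obtain e where e: "e \<in> E" "c e > 0" "hd e \<in> V - U" "tl e \<notin> V - U"
      and safe: "\<And>X. X \<subseteq> V \<Longrightarrow> hd e \<in> X \<Longrightarrow> tl e \<notin> X \<Longrightarrow> k < cut c X"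
      using exists_safe_arc[of U k c] c by metis
    define v where "v = hd e"
    define f' where "f' = f(v := e)"
    define c' where "c' = c(e := c e - 1)"
    have vU: "v \<in> V" "v \<notin> U"
      using e by (auto simp: v_def)
    have "partial (insert v U) f' c'"
      unfolding partial_def
    proof (intro conjI allI ballI impI)
      show "insert v U \<subseteq> V"
        using U vU by auto
    next
      fix w assume "w \<in> insert v U"
      then show "f' w \<in> E" "hd (f' w) = w" "tl (f' w) \<notin> V - insert v U"
        using f[of w] e by (auto simp: f'_def v_def)
    next
      fix X assume X: "X \<subseteq> insert v U \<and> X \<noteq> {}"
      show "\<exists>w\<in>X. tl (f' w) \<notin> X"
      proof (cases "X \<inter> U = {}")
        case True
        then have "X = {v}"
          using X by auto
        then show ?thesis
          using e by (auto simp: f'_def v_def)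
      next
        \<comment> \<open>The tail of \<open>f w\<close> avoids \<open>V - U\<close>, so it is not
          \<open>v\<close>, and leaving \<open>X \<inter> U\<close> means leaving
          \<open>X\<close>.\<close>
        case False
        then obtain w where w: "w \<in> X \<inter> U" "tl (f w) \<notin> X \<inter> U"
          using reach[of "X \<inter> U"] by blast
        moreover have "tl (f w) \<notin> V - U"
          using f w by blast
        ultimately have "tl (f' w) \<notin> X"
          using X U vU by (auto simp: f'_def)
        then show ?thesis
          using w by blast
      qed
    next
      fix a assume a: "a \<in> E"
      show "m a = c' a + of_bool (hd a \<in> insert v U \<and> f' (hd a) = a)"
        using m[OF a] e vU by (auto simp: c'_def f'_def v_def)
    next
      fix X assume X: "X \<subseteq> V \<and> X \<noteq> {}"
      \<comment> \<open>Only sets entered by \<open>e\<close> lose capacity; they lose one unit, and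
        \<open>safe\<close> gives them one to spare.\<close>
      show "k \<le> cut c' X"
      proof (cases "hd e \<in> X \<and> tl e \<notin> X")
        case True
        have "cut c X = cut c' X + 1"
        proof -
          have "(\<Sum>a\<in>E - {e}. if hd a \<in> X \<and> tl a \<notin> X then c a else 0) =
              (\<Sum>a\<in>E - {e}. if hd a \<in> X \<and> tl a \<notin> X then c' a else 0)"
            by (rule sum.cong) (auto simp: c'_def)
          moreover have "c e = c' e + 1"
            using e by (simp add: c'_def)
          ultimately show ?thesis
            unfolding cut_def using True by (simp add: sum.remove[OF finE e(1)])
        qed
        then show ?thesis
          using safe[of X] True X by auto
      next
        case False
        then have "cut c' X = cut c X"
          by (intro cut_cong) (auto simp: c'_def)
        then show ?thesis
          using c X by auto
      qed
    qed
    moreover have "card (insert v U) = Suc n"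
      using cardU vU finite_subset[OF U finV] by simp
    ultimately show ?case
      by blast
  qed
  then obtain U f c where partial: "partial U f c" and "card U = card V"
    by blast
  moreover from this have "U = V"
    using finV by (auto simp: partial_def card_subset_eq)
  ultimately show ?thesis
    using hd_V by (intro that[of f c]) (simp_all add: partial_def)
qed

text \<open>Arborescences are peeled off one at a time. Disjointness takes the form that at most
  \<open>m e\<close> of them use \<open>e\<close>, as if \<open>e\<close> had \<open>m e\<close>
  parallel copies.\<close>

theorem disjoint_arborescences:
  assumes "\<forall>X\<subseteq>V. X \<noteq> {} \<longrightarrow> k \<le> cut m X"
  shows "\<exists>f. (\<forall>i<k. \<forall>v\<in>V. f i v \<in> E \<and> hd (f i v) = v) \<and>
    (\<forall>i<k. \<forall>X. X \<subseteq> V \<and> X \<noteq> {} \<longrightarrow> (\<exists>v\<in>X. tl (f i v) \<notin> X)) \<and>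
    (\<forall>e\<in>E. card {i. i < k \<and> f i (hd e) = e} \<le> m e)"
  using assms
proof (induction k arbitrary: m)
  case 0
  then show ?case
    by simp
next
  case (Suc k)
  obtain g c where g: "\<And>v. v \<in> V \<Longrightarrow> g v \<in> E \<and> hd (g v) = v"
    and reach: "\<And>X. X \<subseteq> V \<Longrightarrow> X \<noteq> {} \<Longrightarrow> \<exists>v\<in>X. tl (g v) \<notin> X"
    and m: "\<And>e. e \<in> E \<Longrightarrow> m e = c e + of_bool (g (hd e) = e)"
    and c: "\<forall>X\<subseteq>V. X \<noteq> {} \<longrightarrow> k \<le> cut c X"
    using exists_removable_arborescence[of k m] Suc.prems by blast
  from Suc.IH[OF c] obtain f where f: "\<forall>i<k. \<forall>v\<in>V. f i v \<in> E \<and> hd (f i v) = v"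
    "\<forall>i<k. \<forall>X. X \<subseteq> V \<and> X \<noteq> {} \<longrightarrow> (\<exists>v\<in>X. tl (f i v) \<notin> X)"
    "\<forall>e\<in>E. card {i. i < k \<and> f i (hd e) = e} \<le> c e"
    by blast
  define f' where "f' = f(k := g)"
  have "card {i. i < Suc k \<and> f' i (hd e) = e} \<le> m e" if e: "e \<in> E" for e
  proof -
    have "{i. i < Suc k \<and> f' i (hd e) = e} =
        {i. i < k \<and> f i (hd e) = e} \<union> (if g (hd e) = e then {k} else {})"
      by (auto simp: f'_def less_Suc_eq)
    then have "card {i. i < Suc k \<and> f' i (hd e) = e} \<le>
        card {i. i < k \<and> f i (hd e) = e} + of_bool (g (hd e) = e)"
      using card_Un_le[of "{i. i < k \<and> f i (hd e) = e}" "{k}"] by auto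
    also have "\<dots> \<le> m e"
      using f(3) m[OF e] e by auto
    finally show ?thesis .
  qed
  moreover have "\<forall>i<Suc k. \<forall>v\<in>V. f' i v \<in> E \<and> hd (f' i v) = v"
    using f(1) g by (auto simp: f'_def less_Suc_eq)
  moreover have "\<forall>i<Suc k. \<forall>X. X \<subseteq> V \<and> X \<noteq> {} \<longrightarrow> (\<exists>v\<in>X. tl (f' i v) \<notin> X)"
    using f(2) reach by (auto simp: f'_def less_Suc_eq)
  ultimately show ?case
    by blast
qed

end

section \<open>Distributing a multiset into sets of equal size\<close>

lemma exists_subset_between_card:
  assumes "L \<subseteq> M" "finite M" "card L \<le> n" "n \<le> card M"
  obtains S where "L \<subseteq> S" "S \<subseteq> M" "card S = n"
proof -
  have "finite L"
    using assms finite_subset by blast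
  then have "n - card L \<le> card (M - L)"
    using assms by (simp add: card_Diff_subset)
  then obtain R where R: "R \<subseteq> M - L" "card R = n - card L" "finite R"
    using obtain_subset_with_card_n by metis
  have "card (L \<union> R) = n"
    using R assms \<open>finite L\<close> by (subst card_Un_disjoint) auto
  then show ?thesis
    using R assms by (intro that[of "L \<union> R"]) auto
qed

text \<open>This distributes the arcs entering one vertex, where \<open>f i\<close> is the arc
  already taken by arborescence \<open>i\<close>. Induction on \<open>k\<close> removes one part,
  chosen so that the hypotheses survive for the others.\<close>

lemma split_multiset_into_transversals:
  fixes m :: "'a \<Rightarrow> nat"
  assumes "finite C" "\<And>e. e \<in> C \<Longrightarrow> m e \<le> k" "(\<Sum>e\<in>C. m e) = k * b"
    "\<And>i. i < k \<Longrightarrow> f i \<in> C" "\<And>e. e \<in> C \<Longrightarrow> card {i. i < k \<and> f i = e} \<le> m e"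
  shows "\<exists>S. (\<forall>i<k. S i \<subseteq> C \<and> f i \<in> S i \<and> card (S i) = b) \<and>
    (\<forall>e\<in>C. card {i. i < k \<and> e \<in> S i} = m e)"
  using assms(2-)
proof (induction k arbitrary: m)
  case 0
  then show ?case
    by simp
next
  case (Suc k)
  define g where "g e = card {i. i < k \<and> f i = e}" for e
  have g_k: "g e \<le> k" for e
    unfolding g_def using card_mono[of "{..<k}" "{i. i < k \<and> f i = e}"] by auto
  have count: "card {i. i < Suc k \<and> f i = e} = g e + of_bool (f k = e)" for e
  proof -
    have "{i. i < Suc k \<and> f i = e} = {i. i < k \<and> f i = e} \<union> (if f k = e then {k} else {})"
      by (auto simp: less_Suc_eq)
    then show ?thesis
      by (simp add: g_def)
  qed
  have g_m: "g e + of_bool (f k = e) \<le> m e" if "e \<in> C" for e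
    using Suc.prems(4)[OF that] by (simp add: count)
  have fk: "f k \<in> C"
    using Suc.prems(3) by simp
  define tight where "tight = {e\<in>C. m e = Suc k}"
  text \<open>The next part must contain \<open>L\<close>, because an element of multiplicity \<open>Suc k\<close> occurs in
    every part, and lie in \<open>M\<close>, because \<open>g e\<close> copies of \<open>e\<close> are reserved for the others.\<close>
  define L where "L = insert (f k) tight"
  define M where "M = {e\<in>C. g e < m e}"
  have L_M: "L \<subseteq> M"
    using g_m[OF fk] fk g_k by (auto simp: L_def M_def tight_def less_Suc_eq_le)
  have fin: "finite M" "finite tight"
    using assms(1) by (auto simp: M_def tight_def)
  have card_L: "card L \<le> b"
  \<comment> \<open>The elements of \<open>tight\<close> use up \<open>Suc k * card tight\<close> of
    the total \<open>Suc k * b\<close>. If \<open>f k\<close> is not among them, its positive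
    multiplicity makes the inequality strict, which leaves room for it in \<open>L\<close>.\<close>
  proof -
    have "Suc k * card tight + (\<Sum>e\<in>C - tight. m e) = Suc k * b"
      unfolding Suc.prems(2)[symmetric] using assms(1)
      by (subst sum.subset_diff[of tight C]) (auto simp: tight_def)
    moreover have "f k \<notin> tight \<Longrightarrow> m (f k) \<le> (\<Sum>e\<in>C - tight. m e)"
      using fk assms(1) by (intro member_le_sum) auto
    moreover have "m (f k) > 0"
      using g_m[OF fk] by simp
    ultimately have "Suc k * card tight \<le> Suc k * b \<and> (f k \<notin> tight \<longrightarrow> Suc k * card tight < Suc k * b)"
      by linarith
    then have "card tight \<le> b \<and> (f k \<notin> tight \<longrightarrow> card tight < b)"
      by (metis mult_le_cancel1 mult_less_cancel1 zero_less_Suc)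
    then show ?thesis
      using fin by (cases "f k \<in> tight") (auto simp: L_def insert_absorb)
  qed
  have card_M: "b \<le> card M"
  \<comment> \<open>An element outside \<open>M\<close> has at most \<open>g e\<close> copies, and
    the \<open>g e\<close> sum to at most \<open>k\<close>; an element of \<open>M\<close> has at
    most \<open>Suc k\<close> copies. With fewer than \<open>b\<close> elements in \<open>M\<close>
    the total would stay below \<open>Suc k * b\<close>.\<close>
  proof (rule ccontr)
    assume "\<not> b \<le> card M"
    then have *: "Suc (card M) \<le> b"
      by simp
    have "(\<Sum>e\<in>C. g e) = card (\<Union>e\<in>C. {i. i < k \<and> f i = e})"
      unfolding g_def using assms(1) by (intro card_UN_disjoint[symmetric]) auto
    also have "\<dots> \<le> card {..<k}"
      by (rule card_mono) auto
    finally have "(\<Sum>e\<in>C. g e) \<le> k"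
      by simp
    moreover have "(\<Sum>e\<in>C. m e) \<le> (\<Sum>e\<in>C. g e + (if e \<in> M then Suc k else 0))"
    proof (rule sum_mono)
      fix e assume "e \<in> C"
      with Suc.prems(1)[of e] show "m e \<le> g e + (if e \<in> M then Suc k else 0)"
        by (simp add: M_def)
    qed
    moreover have "(\<Sum>e\<in>C. if e \<in> M then Suc k else 0) = card M * Suc k"
      using assms(1) by (subst sum.inter_restrict[symmetric]) (auto simp: M_def Int_absorb1 Int_def)
    ultimately have "Suc k * b \<le> k + card M * Suc k"
      using Suc.prems(2) by (simp add: sum.distrib)
    also have "\<dots> < Suc k * Suc (card M)"
      by simp
    also have "\<dots> \<le> Suc k * b"
      using * by (rule mult_le_mono2)
    finally show False
      by simp
  qed
  obtain S0 where S0: "L \<subseteq> S0" "S0 \<subseteq> M" "card S0 = b"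
    using exists_subset_between_card[OF L_M fin(1) card_L card_M] by metis
  have S0_C: "S0 \<subseteq> C"
    using S0 by (auto simp: M_def)
  define m' where "m' e = m e - of_bool (e \<in> S0)" for e
  have m_m': "m e = m' e + of_bool (e \<in> S0)" if "e \<in> C" for e
    using S0 by (auto simp: m'_def M_def)
  \<comment> \<open>Since \<open>L \<subseteq> S0\<close>, multiplicities drop to at most
    \<open>k\<close>; since \<open>S0 \<subseteq> M\<close>, the reserved copies remain.\<close>
  have "\<exists>S. (\<forall>i<k. S i \<subseteq> C \<and> f i \<in> S i \<and> card (S i) = b) \<and>
    (\<forall>e\<in>C. card {i. i < k \<and> e \<in> S i} = m' e)"
  proof (rule Suc.IH)
    fix e assume e: "e \<in> C"
    show "m' e \<le> k"
      using Suc.prems(1)[OF e] e S0 by (auto simp: m'_def L_def tight_def le_Suc_eq)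
    show "card {i. i < k \<and> f i = e} \<le> m' e"
      using g_m[OF e] S0 by (auto simp: m'_def M_def g_def[symmetric] L_def)
  next
    have "(\<Sum>e\<in>C. m e) = (\<Sum>e\<in>C. m' e) + (\<Sum>e\<in>C. of_bool (e \<in> S0))"
      unfolding sum.distrib[symmetric] by (rule sum.cong) (auto simp: m_m')
    also have "(\<Sum>e\<in>C. of_bool (e \<in> S0)) = card S0"
      using S0_C assms(1) by (simp add: Int_absorb1)
    finally show "(\<Sum>e\<in>C. m' e) = k * b"
      using Suc.prems(2) S0 by simp
  next
    fix i assume "i < k"
    then show "f i \<in> C"
      using Suc.prems(3) by simp
  qed
  then obtain S where S: "\<forall>i<k. S i \<subseteq> C \<and> f i \<in> S i \<and> card (S i) = b"
    "\<forall>e\<in>C. card {i. i < k \<and> e \<in> S i} = m' e"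
    by blast
  define S' where "S' = S(k := S0)"
  have "\<forall>i<Suc k. S' i \<subseteq> C \<and> f i \<in> S' i \<and> card (S' i) = b"
    using S(1) S0 S0_C by (auto simp: S'_def less_Suc_eq L_def)
  moreover have "card {i. i < Suc k \<and> e \<in> S' i} = m e" if e: "e \<in> C" for e
  proof -
    have "{i. i < Suc k \<and> e \<in> S' i} = {i. i < k \<and> e \<in> S i} \<union> (if e \<in> S0 then {k} else {})"
      by (auto simp: less_Suc_eq S'_def)
    then show ?thesis
      using S(2) e m_m'[OF e] by simp
  qed
  ultimately show ?case
    by blast
qed

section \<open>Decomposing an arc multiset into b-branchings\<close>

text \<open>Each hypothesis on \<open>n\<close> is the sum over \<open>k\<close> parts of a
  constraint on one part. Padding with root arcs turns sparsity into the cut condition of Edmonds'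
  theorem. Sparsity is stated additively to avoid truncated subtraction.\<close>

lemma decompose_into_b_branchings:
  fixes D :: "('v, 'e) pre_digraph" and n :: "'e \<Rightarrow> nat"
  assumes "fin_digraph D"
    and V': "V' \<subseteq> verts D"
    and b': "\<And>v. v \<in> V' \<Longrightarrow> b' v \<le> b v"
    and n_le: "\<And>e. e \<in> arcs D \<Longrightarrow> n e \<le> k"
    and indeg_le: "\<And>v. v \<in> verts D \<Longrightarrow> (\<Sum>e\<in>in_arcs D v. n e) \<le> k * b v"
    and indeg_eq: "\<And>v. v \<in> V' \<Longrightarrow> (\<Sum>e\<in>in_arcs D v. n e) = k * b' v"
    and sparse: "\<And>X. X \<subseteq> verts D \<Longrightarrow> X \<noteq> {} \<Longrightarrow>
      (\<Sum>e\<in>arcs_inside D (arcs D) X. n e) + k \<le> k * (\<Sum>v\<in>X. b v)"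
  shows "\<exists>B. (\<forall>i<k. b_branching D b (B i) \<and> (\<forall>v\<in>V'. indeg_in D (B i) v = b' v)) \<and>
    (\<forall>e\<in>arcs D. card {i. i < k \<and> e \<in> B i} = n e)"
proof -
  interpret D: fin_digraph D
    by fact
  \<comment> \<open>There are \<open>t v\<close> root arcs into \<open>v\<close>, each of
    multiplicity \<open>mult v\<close>. In both cases they fill the in-degree up to
    \<open>k * b v\<close>; on \<open>V'\<close> full multiplicity \<open>k\<close> will force each
    of them into every part.\<close>
  define t where "t v = (if v \<in> V' then b v - b' v else k * b v - (\<Sum>e\<in>in_arcs D v. n e))" for v
  define mult where "mult v = (if v \<in> V' then k else 1)" for v
  \<comment> \<open>\<open>Inl\<close> marks arcs of \<open>D\<close>, \<open>Inr (v, j)\<close> is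
    the root arc number \<open>j\<close> into \<open>v\<close>, and \<open>None\<close> is the
    root.\<close>
  define E where "E = Inl ` arcs D \<union> Inr ` (SIGMA v:verts D. {..<t v})"
  define hd where "hd = case_sum (\<lambda>e. Some (head D e)) (\<lambda>p :: 'v \<times> nat. Some (fst p))"
  define tl where "tl = case_sum (\<lambda>e. Some (tail D e)) (\<lambda>p :: 'v \<times> nat. None)"
  define m where "m = case_sum n (\<lambda>p :: 'v \<times> nat. mult (fst p))"
  define C where "C v = {e \<in> E. hd e = Some v}" for v
  interpret capacitated_digraph E hd tl "Some ` verts D"
  proof
    show "finite E"
      by (auto simp: E_def)
    show "hd e \<in> Some ` verts D" if "e \<in> E" for e
      using that by (auto simp: E_def hd_def)
  qed auto
  have fin_C: "finite (C v)" for v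
    using finE by (auto simp: C_def)
  have C_eq: "C v = Inl ` in_arcs D v \<union> Inr ` ({v} \<times> {..<t v})" if "v \<in> verts D" for v
    using that by (auto simp: C_def E_def hd_def)
  have sum_C: "(\<Sum>e\<in>C v. m e) = k * b v" if v: "v \<in> verts D" for v
  proof -
    have "(\<Sum>e\<in>C v. m e) = (\<Sum>e\<in>in_arcs D v. n e) + (\<Sum>p\<in>{v} \<times> {..<t v}. mult (fst p))"
      unfolding C_eq[OF v]
      by (subst sum.union_disjoint) (auto simp: sum.reindex m_def o_def)
    also have "(\<Sum>p\<in>{v} \<times> {..<t v}. mult (fst p)) = (\<Sum>p\<in>{v} \<times> {..<t v}. mult v)"
      by (rule sum.cong) auto
    also have "\<dots> = t v * mult v"
      by (simp add: card_cartesian_product)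
    also have "(\<Sum>e\<in>in_arcs D v. n e) + t v * mult v = k * b v"
      using indeg_le[OF v] indeg_eq[of v] b'[of v]
      by (auto simp: t_def mult_def algebra_simps diff_mult_distrib2)
    finally show ?thesis .
  qed
  have "\<forall>X\<subseteq>Some ` verts D. X \<noteq> {} \<longrightarrow> k \<le> cut m X"
  proof (intro allI impI)
    fix X :: "'v option set"
    assume X: "X \<subseteq> Some ` verts D" "X \<noteq> {}"
    obtain Y where Y: "Y \<subseteq> verts D" "X = Some ` Y"
      using X by (auto elim: subset_imageE)
    have finY: "finite Y"
      using finite_subset[OF Y(1)] by simp
    \<comment> \<open>The arcs with head in \<open>Y\<close> either enter \<open>X\<close> or lie
      inside \<open>Y\<close>. Sparsity bounds the latter, so at least \<open>k\<close>
      enter.\<close>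
    have "k * (\<Sum>v\<in>Y. b v) = (\<Sum>v\<in>Y. \<Sum>e\<in>C v. m e)"
      unfolding sum_distrib_left using Y sum_C by (intro sum.cong) auto
    also have "\<dots> = (\<Sum>e\<in>(\<Union>v\<in>Y. C v). m e)"
      using finY fin_C by (intro sum.UNION_disjoint[symmetric]) (auto simp: C_def)
    also have "(\<Union>v\<in>Y. C v) = {e\<in>E. hd e \<in> X \<and> tl e \<notin> X} \<union> Inl ` arcs_inside D (arcs D) Y"
      using Y by (auto simp: C_def E_def hd_def tl_def arcs_inside_def)
    also have "(\<Sum>e\<in>\<dots>. m e) = (\<Sum>e\<in>{e\<in>E. hd e \<in> X \<and> tl e \<notin> X}. m e)
        + (\<Sum>e\<in>Inl ` arcs_inside D (arcs D) Y. m e)"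
      using finE Y by (intro sum.union_disjoint) (auto simp: arcs_inside_def tl_def)
    also have "(\<Sum>e\<in>{e\<in>E. hd e \<in> X \<and> tl e \<notin> X}. m e) = cut m X"
      unfolding cut_def using finE by (rule sum.inter_filter)
    also have "(\<Sum>e\<in>Inl ` arcs_inside D (arcs D) Y. m e) = (\<Sum>e\<in>arcs_inside D (arcs D) Y. n e)"
      by (simp add: sum.reindex m_def)
    finally show "k \<le> cut m X"
      using sparse[of Y] X Y by auto
  qed
  from disjoint_arborescences[OF this] obtain f where
    f: "\<forall>i<k. \<forall>v\<in>Some ` verts D. f i v \<in> E \<and> hd (f i v) = v"
    and reach: "\<forall>i<k. \<forall>X. X \<subseteq> Some ` verts D \<and> X \<noteq> {} \<longrightarrow> (\<exists>v\<in>X. tl (f i v) \<notin> X)"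
    and f_m: "\<forall>e\<in>E. card {i. i < k \<and> f i (hd e) = e} \<le> m e"
    by (elim exE conjE) (rule that)
  have "\<exists>S. (\<forall>i<k. S i \<subseteq> C v \<and> f i (Some v) \<in> S i \<and> card (S i) = b v) \<and>
      (\<forall>e\<in>C v. card {i. i < k \<and> e \<in> S i} = m e)" if v: "v \<in> verts D" for v
  proof (rule split_multiset_into_transversals)
    show "finite (C v)"
      by (rule fin_C)
    show "(\<Sum>e\<in>C v. m e) = k * b v"
      using v by (rule sum_C)
    show "f i (Some v) \<in> C v" if "i < k" for i
      using f that v by (auto simp: C_def)
    fix e assume e: "e \<in> C v"
    then show "card {i. i < k \<and> f i (Some v) = e} \<le> m e"
      using f_m by (auto simp: C_def)
    show "m e \<le> k"
    proof (cases e)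
      case (Inl a)
      then show ?thesis
        using e n_le by (auto simp: C_def E_def m_def)
    next
      \<comment> \<open>Off \<open>V'\<close> the multiplicity is 1, and the existence of a root arc
        there excludes \<open>k = 0\<close>.\<close>
      case (Inr p)
      then have "p \<in> {v} \<times> {..<t v}"
        using e C_eq[OF v] by auto
      then have "t v > 0"
        by auto
      then have "k > 0 \<or> v \<in> V'"
        by (auto simp: t_def split: if_splits intro: gr0I)
      then show ?thesis
        using Inr \<open>p \<in> _\<close> by (auto simp: m_def mult_def)
    qed
  qed
  then have "\<forall>v\<in>verts D. \<exists>S. (\<forall>i<k. S i \<subseteq> C v \<and> f i (Some v) \<in> S i \<and> card (S i) = b v) \<and>
      (\<forall>e\<in>C v. card {i. i < k \<and> e \<in> S i} = m e)"
    by blast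
  then obtain S where "\<forall>v\<in>verts D.
      (\<forall>i<k. S v i \<subseteq> C v \<and> f i (Some v) \<in> S v i \<and> card (S v i) = b v) \<and>
      (\<forall>e\<in>C v. card {i. i < k \<and> e \<in> S v i} = m e)"
    by (rule bchoice[THEN exE])
  then have S: "\<And>v i. v \<in> verts D \<Longrightarrow> i < k \<Longrightarrow>
      S v i \<subseteq> C v \<and> f i (Some v) \<in> S v i \<and> card (S v i) = b v"
    and S_m: "\<And>v e. v \<in> verts D \<Longrightarrow> e \<in> C v \<Longrightarrow> card {i. i < k \<and> e \<in> S v i} = m e"
    by blast+
  have fin_S: "finite (S v i)" if "v \<in> verts D" "i < k" for v i
    using S[OF that] fin_C finite_subset by blast
  \<comment> \<open>Part \<open>i\<close> joins the sets \<open>S v i\<close> over all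
    \<open>v\<close> and drops the root arcs.\<close>
  define B where "B i = {e \<in> arcs D. Inl e \<in> S (head D e) i}" for i
  have S_sub: "S v i \<subseteq> Inl ` in_arcs D v \<union> Inr ` ({v} \<times> {..<t v})" if "v \<in> verts D" "i < k" for v i
    using S[OF that] unfolding C_eq[OF that(1)] by (elim conjE)
  have indeg: "Inl ` (B i \<inter> in_arcs D v) = S v i - range Inr" if "v \<in> verts D" "i < k" for v i
  proof
    show "Inl ` (B i \<inter> in_arcs D v) \<subseteq> S v i - range Inr"
      by (auto simp: B_def)
    show "S v i - range Inr \<subseteq> Inl ` (B i \<inter> in_arcs D v)"
    proof
      fix e assume e: "e \<in> S v i - range Inr"
      with S_sub[OF that] obtain a where "e = Inl a" "a \<in> in_arcs D v"
        by blast
      with e show "e \<in> Inl ` (B i \<inter> in_arcs D v)"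
        by (auto simp: B_def)
    qed
  qed
  have indeg_card: "indeg_in D (B i) v = card (S v i - range Inr)" if "v \<in> verts D" "i < k" for v i
    unfolding indeg_in_def indeg[OF that, symmetric] by (simp add: card_image)
  have "b_branching D b (B i)" if i: "i < k" for i
    unfolding b_branching_def
  proof (intro conjI ballI allI impI)
    show "B i \<subseteq> arcs D"
      by (auto simp: B_def)
    show "indeg_in D (B i) v \<le> b v" if v: "v \<in> verts D" for v
      using S[OF v i] fin_S[OF v i] indeg_card[OF v i] by (metis Diff_subset card_mono)
  next
    fix X assume X: "X \<subseteq> verts D \<and> X \<noteq> {}"
    then have "\<exists>w\<in>Some ` X. tl (f i w) \<notin> Some ` X"
      using reach i by (metis image_is_empty image_mono)
    then obtain w where w: "w \<in> X" "tl (f i (Some w)) \<notin> Some ` X"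
      by blast
    have finX: "finite X"
      using X finite_subset[of X "verts D"] by simp
    \<comment> \<open>The arborescence arc into \<open>w\<close> belongs to \<open>S w i\<close> but
      comes from outside \<open>X\<close>; it accounts for the \<open>- 1\<close> in the sparsity
      bound.\<close>
    have "Inl ` arcs_inside D (B i) X \<subseteq> (\<Union>v\<in>X. S v i) - {f i (Some w)}"
      using w by (cases "f i (Some w)") (auto simp: arcs_inside_def B_def tl_def)
    moreover have fin: "finite (\<Union>v\<in>X. S v i)"
      using finX X i fin_S by auto
    ultimately have "card (Inl ` arcs_inside D (B i) X :: ('e + 'v \<times> nat) set)
        \<le> card ((\<Union>v\<in>X. S v i) - {f i (Some w)})"
      by (intro card_mono) auto
    then have "card (arcs_inside D (B i) X) \<le> card ((\<Union>v\<in>X. S v i) - {f i (Some w)})"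
      by (simp add: card_image)
    also have "\<dots> < card (\<Union>v\<in>X. S v i)"
      using w X S i by (intro card_Diff1_less fin) blast
    also have "\<dots> \<le> (\<Sum>v\<in>X. card (S v i))"
      using finX by (rule card_UN_le)
    also have "\<dots> = (\<Sum>v\<in>X. b v)"
      using X S i by (intro sum.cong) auto
    finally show "int (card (arcs_inside D (B i) X)) \<le> int (\<Sum>v\<in>X. b v) - 1"
      by linarith
  qed
  moreover have "indeg_in D (B i) v = b' v" if i: "i < k" and v: "v \<in> V'" for i v
  proof -
    have vD: "v \<in> verts D"
      using v V' by auto
    \<comment> \<open>With multiplicity \<open>k\<close> and at most one copy per part, the root arc
      lies in all \<open>k\<close> parts. So \<open>b v - b' v\<close> of the \<open>b v\<close>
      elements of \<open>S v i\<close> are root arcs, leaving \<open>b' v\<close>.\<close>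
    have root: "Inr (v, j) \<in> S v i" if j: "j < t v" for j
    proof -
      have "Inr (v, j) \<in> C v"
        using C_eq[OF vD] j by auto
      then have "card {i. i < k \<and> Inr (v, j) \<in> S v i} = card {..<k}"
        using S_m[OF vD] v by (simp add: m_def mult_def)
      moreover have "{i. i < k \<and> Inr (v, j) \<in> S v i} \<subseteq> {..<k}"
        by auto
      ultimately have "{i. i < k \<and> Inr (v, j) \<in> S v i} = {..<k}"
        by (intro card_subset_eq) auto
      then show ?thesis
        using i by auto
    qed
    have "S v i \<inter> range Inr = Inr ` ({v} \<times> {..<t v})"
      using root S_sub[OF vD i] by auto
    then have "card (S v i \<inter> range Inr) = b v - b' v"
      using v by (simp add: card_image card_cartesian_product t_def)
    then show ?thesis
      using indeg_card[OF vD i] S[OF vD i] fin_S[OF vD i] b'[OF v]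
      by (simp add: card_Diff_subset_Int)
  qed
  moreover have "card {i. i < k \<and> e \<in> B i} = n e" if e: "e \<in> arcs D" for e
  proof -
    have "Inl e \<in> C (head D e)"
      using e by (auto simp: C_def E_def hd_def)
    then have "card {i. i < k \<and> Inl e \<in> S (head D e) i} = n e"
      using S_m[of "head D e" "Inl e"] e by (simp add: m_def)
    then show ?thesis
      using e by (simp add: B_def)
  qed
  ultimately show ?thesis
    by blast
qed

section \<open>Linear inequalities on hulls of incidence vectors\<close>

lemma sum_eq_inner_incidence_vector:
  fixes x :: "real ^ 'e::finite"
  shows "(\<Sum>e\<in>F. x $ e) = incidence_vector F \<bullet> x"
proof -
  have "incidence_vector F \<bullet> x = (\<Sum>e\<in>UNIV. if e \<in> F then x $ e else 0)"
    unfolding inner_vec_def by (rule sum.cong) (auto simp: incidence_vector_def)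
  also have "\<dots> = (\<Sum>e\<in>F. x $ e)"
    by (simp add: sum.If_cases)
  finally show ?thesis ..
qed

lemma inner_incidence_vectors:
  fixes F B :: "'e::finite set"
  shows "incidence_vector F \<bullet> incidence_vector B = real (card (B \<inter> F))"
  unfolding sum_eq_inner_incidence_vector[symmetric]
  by (simp add: incidence_vector_def sum.If_cases Int_commute)

text \<open>The inequality defines a halfspace, which is convex and contains all generators.\<close>

lemma sum_le_on_hull_of_incidence_vectors:
  fixes S :: "'e::finite set set"
  assumes "\<And>B. B \<in> S \<Longrightarrow> real (card (B \<inter> F)) \<le> c" "x \<in> convex hull (incidence_vector ` S)"
  shows "(\<Sum>e\<in>F. x $ e) \<le> c"
proof -
  have "convex hull (incidence_vector ` S) \<subseteq> {x. incidence_vector F \<bullet> x \<le> c}"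
    using assms(1) by (intro hull_minimal convex_halfspace_le) (auto simp: inner_incidence_vectors)
  with assms(2) show ?thesis
    by (auto simp: sum_eq_inner_incidence_vector)
qed

lemma sum_ge_on_hull_of_incidence_vectors:
  fixes S :: "'e::finite set set"
  assumes "\<And>B. B \<in> S \<Longrightarrow> c \<le> real (card (B \<inter> F))" "x \<in> convex hull (incidence_vector ` S)"
  shows "c \<le> (\<Sum>e\<in>F. x $ e)"
proof -
  have "convex hull (incidence_vector ` S) \<subseteq> {x. incidence_vector F \<bullet> x \<ge> c}"
    using assms(1) by (intro hull_minimal convex_halfspace_ge) (auto simp: inner_incidence_vectors)
  with assms(2) show ?thesis
    by (auto simp: sum_eq_inner_incidence_vector)
qed

section \<open>The integer decomposition property\<close>

theorem theorem1p10:
  fixes D :: "('v, 'e::finite) pre_digraph"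
    and b b' :: "'v \<Rightarrow> nat"
    and V' :: "'v set"
  assumes "fin_digraph D"
    and "\<And>v. v \<in> verts D \<Longrightarrow> b v > 0"
    and "V' \<subseteq> verts D"
    and "\<And>v. v \<in> V' \<Longrightarrow> b' v \<le> b v"
  shows "integer_decomposition_property (prescribed_b_branching_polytope D b V' b')"
proof -
  interpret D: fin_digraph D
    by fact
  define S where "S = {B. b_branching D b B \<and> (\<forall>v\<in>V'. indeg_in D B v = b' v)}"
  have P: "prescribed_b_branching_polytope D b V' b' = convex hull (incidence_vector ` S)"
    by (simp add: prescribed_b_branching_polytope_def S_def)
  show ?thesis
    unfolding integer_decomposition_property_def P
  proof (intro allI impI, elim conjE imageE)
    fix k :: nat and x x' :: "real ^ 'e"
    assume k: "k > 0" and int: "integer_vector x" and x: "x = real k *\<^sub>R x'"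
      and x': "x' \<in> convex hull (incidence_vector ` S)"
    note upper = sum_le_on_hull_of_incidence_vectors[OF _ x']
      and lower = sum_ge_on_hull_of_incidence_vectors[OF _ x']
    have sum_x: "(\<Sum>e\<in>F. x $ e) = real k * (\<Sum>e\<in>F. x' $ e)" for F
      by (simp add: x sum_distrib_left)
    have nonneg: "0 \<le> x $ e" for e
      using lower[of 0 "{e}"] by (simp add: x)
    define n where "n e = nat \<lfloor>x $ e\<rfloor>" for e
    have n: "real (n e) = x $ e" for e
      using int nonneg[of e] by (auto simp: n_def integer_vector_def elim!: Ints_cases)
    \<comment> \<open>A bound valid for every member of \<open>S\<close> passes to \<open>x'\<close>
      by convexity and to \<open>n\<close> by scaling, so the constraints on \<open>n\<close> need
      checking only on single b-branchings.\<close>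
    have n_le: "(\<Sum>e\<in>F. n e) \<le> k * c" if "\<And>B. B \<in> S \<Longrightarrow> card (B \<inter> F) \<le> c" for F c
    proof -
      have "real k * (\<Sum>e\<in>F. x' $ e) \<le> real k * real c"
        using upper[of F "real c"] that by (intro mult_left_mono) auto
      then have "real (\<Sum>e\<in>F. n e) \<le> real (k * c)"
        by (simp add: n sum_x)
      then show ?thesis
        by (simp only: of_nat_le_iff)
    qed
    have n_ge: "k * c \<le> (\<Sum>e\<in>F. n e)" if "\<And>B. B \<in> S \<Longrightarrow> c \<le> card (B \<inter> F)" for F c
    proof -
      have "real k * real c \<le> real k * (\<Sum>e\<in>F. x' $ e)"
        using lower[of "real c" F] that by (intro mult_left_mono) auto
      then have "real (k * c) \<le> real (\<Sum>e\<in>F. n e)"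
        by (simp add: n sum_x)
      then show ?thesis
        by (simp only: of_nat_le_iff)
    qed
    have "\<exists>B. (\<forall>i<k. b_branching D b (B i) \<and> (\<forall>v\<in>V'. indeg_in D (B i) v = b' v)) \<and>
        (\<forall>e\<in>arcs D. card {i. i < k \<and> e \<in> B i} = n e)"
    proof (rule decompose_into_b_branchings[OF assms(1,3,4)])
      show "n e \<le> k" for e
      proof -
        have "card (B \<inter> {e}) \<le> 1" for B
          by (rule order.trans[OF card_mono[of "{e}"]]) auto
        then show ?thesis
          using n_le[of "{e}" 1] by simp
      qed
      show "(\<Sum>e\<in>in_arcs D v. n e) \<le> k * b v" if "v \<in> verts D" for v
        using that by (intro n_le) (auto simp: S_def b_branching_def indeg_in_def)
      show "(\<Sum>e\<in>in_arcs D v. n e) = k * b' v" if "v \<in> V'" for v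
        using that by (intro antisym n_le n_ge) (auto simp: S_def indeg_in_def)
      show "(\<Sum>e\<in>arcs_inside D (arcs D) X. n e) + k \<le> k * (\<Sum>v\<in>X. b v)"
        if X: "X \<subseteq> verts D" "X \<noteq> {}" for X
      proof -
        obtain v where "v \<in> X" "finite X"
          using X finite_subset[OF X(1)] by auto
        \<comment> \<open>Positivity of \<open>b\<close> enters here: it makes the natural-number
          subtraction of 1 below exact.\<close>
        then have pos: "(\<Sum>v\<in>X. b v) > 0"
          using assms(2)[of v] X by (auto simp: sum_pos2)
        have "(\<Sum>e\<in>arcs_inside D (arcs D) X. n e) \<le> k * ((\<Sum>v\<in>X. b v) - 1)"
        proof (rule n_le)
          fix B assume B: "B \<in> S"
          then have "B \<inter> arcs_inside D (arcs D) X = arcs_inside D B X"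
            by (auto simp: S_def b_branching_def arcs_inside_def)
          moreover have "int (card (arcs_inside D B X)) \<le> int (\<Sum>v\<in>X. b v) - 1"
            using B X by (auto simp: S_def b_branching_def)
          ultimately have "int (card (B \<inter> arcs_inside D (arcs D) X)) \<le> int (\<Sum>v\<in>X. b v) - 1"
            by (simp only:)
          then show "card (B \<inter> arcs_inside D (arcs D) X) \<le> (\<Sum>v\<in>X. b v) - 1"
            by linarith
        qed
        also have "\<dots> = k * (\<Sum>v\<in>X. b v) - k"
          by (simp add: diff_mult_distrib2)
        finally show ?thesis
          using pos by (cases "\<Sum>v\<in>X. b v") auto
      qed
    qed
    then obtain B where B: "\<And>i. i < k \<Longrightarrow> B i \<in> S"
      and count: "\<And>e. e \<in> arcs D \<Longrightarrow> card {i. i < k \<and> e \<in> B i} = n e"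
      by (auto simp: S_def)
    \<comment> \<open>Coordinates range over the whole type; outside \<open>arcs D\<close> both
      sides vanish, as no member of \<open>S\<close> contains \<open>e\<close>.\<close>
    have count': "card {i. i < k \<and> e \<in> B i} = n e" for e
    proof (cases "e \<in> arcs D")
      case False
      then have not_in: "e \<notin> B'" if "B' \<in> S" for B'
        using that by (auto simp: S_def b_branching_def)
      then have "{i. i < k \<and> e \<in> B i} = {}"
        using B by auto
      moreover have "n e = 0"
        using n_le[of "{e}" 0] not_in by simp
      ultimately show ?thesis
        by (simp only: card.empty)
    qed (rule count)
    \<comment> \<open>The parts are numbered from 0, the summands from 1.\<close>
    define y where "y i = incidence_vector (B (i - 1))" for i
    have "x = (\<Sum>i=1..k. y i)"
    proof -
      have "(\<Sum>i=1..k. y i) = (\<Sum>i<k. incidence_vector (B i))"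
        by (rule sum.reindex_bij_witness[of _ Suc "\<lambda>i. i - 1"]) (auto simp: y_def)
      then have "(\<Sum>i=1..k. y i) $ e = real (card {i. i < k \<and> e \<in> B i})" for e
        by (simp add: incidence_vector_def sum.inter_filter[symmetric])
      then show ?thesis
        by (simp add: vec_eq_iff count' n)
    qed
    moreover have "integer_vector (y i) \<and> y i \<in> convex hull (incidence_vector ` S)"
      if "i \<in> {1..k}" for i
    proof -
      have "B (i - 1) \<in> S"
        using that by (intro B) auto
      then show ?thesis
        by (auto simp: y_def integer_vector_def incidence_vector_def intro: hull_inc)
    qed
    ultimately show "\<exists>y. (\<forall>i\<in>{1..k}. integer_vector (y i) \<and>
        y i \<in> convex hull (incidence_vector ` S)) \<and> x = (\<Sum>i=1..k. y i)"
      by blast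
  qed
qed

end
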